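(* For every integer $r\geq 0$, the following identity of rational functions in one variable $w$ holds: $$\frac{1}{(1-w^2)^2(1-w)^{r-1}}\left(\frac{1-(1+w^2)^r(1-w)^r}{1-(1+w^2)(1-w)}-\frac{1-(1-w)^r}{1-(1-w)}\right)=\frac{-1}{w(1+w^3)}\left[\frac{(1+w^2)^r-1}{1-w^2}+\frac{w\bigl[(1-w)^r-1\bigr]}{(1-w)^r(1+w)}\right].$$
   Context: Both sides are elements of the field $\mathbb{Q}(w)$ of rational functions. *)

theory Defs
  imports "HOL-Computational_Algebra.Polynomial_Factorial"
begin

text \<open>
  The field \<open>\<rat>(w)\<close> of rational functions is the fraction field \<open>rat poly fract\<close> of
  \<open>\<rat>[w]\<close>; \<open>ratfun_var\<close> is the image of the indeterminate \<open>w\<close>.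
\<close>

definition ratfun_var :: "rat poly fract"
  where "ratfun_var = to_fract [:0, 1:]"

text \<open>
  Division by zero in \<open>rat poly fract\<close> yields zero; the following shows that none of
  the denominators built from these expressions degenerates.
\<close>

lemma ratfun_var_denominators_nonzero:
  fixes w :: "rat poly fract"
  assumes "w = ratfun_var"
  shows "w \<noteq> 0" "1 - w \<noteq> 0" "1 + w \<noteq> 0" "1 - w ^ 2 \<noteq> 0" "1 + w ^ 3 \<noteq> 0"
    "1 - (1 + w ^ 2) * (1 - w) \<noteq> 0" "1 - (1 - w) \<noteq> 0"
proof -
  have *: "w = to_fract [:0, 1:]" "(1 :: rat poly fract) = to_fract 1"
    using assms by (simp_all add: ratfun_var_def)
  have p: "to_fract x ^ n = to_fract (x ^ n)" for x :: "rat poly" and n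
    by (induction n) simp_all
  show "w \<noteq> 0" "1 - w \<noteq> 0" "1 + w \<noteq> 0" "1 - w ^ 2 \<noteq> 0" "1 + w ^ 3 \<noteq> 0"
    "1 - (1 + w ^ 2) * (1 - w) \<noteq> 0" "1 - (1 - w) \<noteq> 0"
    unfolding * p to_fract_add[symmetric] to_fract_diff[symmetric] to_fract_mult[symmetric]
      to_fract_eq_0_iff
    by (simp_all add: one_pCons power2_eq_square power3_eq_cube)
qed

end

theory Submission
  imports Defs
begin

text \<open>
  With \<open>a = (1 + w^2)^r\<close> and \<open>b = (1 - w)^r\<close> treated as independent quantities, and
  \<open>q = 1 - w + w^2\<close>, one has \<open>1 - (1 + w^2) (1 - w) = w q\<close> and \<open>1 + w^3 = (1 + w) q\<close>.
  Both sides then equal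
  \<open>(w (1 - w) (1 - b) - b (a - 1)) / (w (1 - w) (1 + w)^2 q b)\<close>.
\<close>

lemma rational_identity:
  fixes w a b :: "'a :: field"
  assumes "w \<noteq> 0" "1 - w \<noteq> 0" "1 + w \<noteq> 0" "1 - w + w\<^sup>2 \<noteq> 0" "b \<noteq> 0"
  shows "1 / ((1 - w ^ 2) ^ 2 * (b / (1 - w))) *
           ((1 - a * b) / (1 - (1 + w ^ 2) * (1 - w)) - (1 - b) / (1 - (1 - w)))
       = (- 1) / (w * (1 + w ^ 3)) *
           ((a - 1) / (1 - w ^ 2) + (w * (b - 1)) / (b * (1 + w)))"
proof -
  \<comment> \<open>With \<open>u\<close>, \<open>v\<close>, \<open>q\<close> kept opaque, clearing
    denominators only meets products of nonzero atoms.\<close>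
  define u v q where "u = 1 - w" and "v = 1 + w" and "q = 1 - w + w\<^sup>2"
  have nz: "w \<noteq> 0" "u \<noteq> 0" "v \<noteq> 0" "q \<noteq> 0" "b \<noteq> 0"
    using assms by (simp_all add: u_def v_def q_def)
  have factor: "1 - w ^ 2 = u * v" "1 - (1 + w ^ 2) * (1 - w) = w * q" "1 + w ^ 3 = v * q"
    by (simp_all add: u_def v_def q_def algebra_simps power2_eq_square power3_eq_cube)
  have "1 / ((u * v) ^ 2 * (b / u)) * ((1 - a * b) / (w * q) - (1 - b) / w)
      = (1 - a * b - (1 - b) * q) / (w * u * v ^ 2 * q * b)"
    using nz by (simp add: divide_simps) (simp add: algebra_simps power2_eq_square)
  \<comment> \<open>Substituting \<open>q = 1 - w * u\<close> cancels the constant 1 and leaves one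
    term in \<open>a - 1\<close> and one in \<open>b - 1\<close>, matching the two summands on the
    right.\<close>
  also have "1 - a * b - (1 - b) * q = - (b * (a - 1) + w * u * (b - 1))"
    by (simp add: u_def q_def algebra_simps power2_eq_square)
  also have "- (b * (a - 1) + w * u * (b - 1)) / (w * u * v ^ 2 * q * b)
      = (- 1) / (w * (v * q)) * ((a - 1) / (u * v) + (w * (b - 1)) / (b * v))"
    using nz by (simp add: divide_simps) (simp add: algebra_simps power2_eq_square)
  finally show ?thesis
    unfolding factor by (simp add: u_def v_def)
qed

theorem lemma22:
  fixes r :: nat
  shows "let w = ratfun_var in
       1 / ((1 - w ^ 2) ^ 2 * (1 - w) powi (int r - 1)) *
           ((1 - (1 + w ^ 2) ^ r * (1 - w) ^ r) / (1 - (1 + w ^ 2) * (1 - w))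
            - (1 - (1 - w) ^ r) / (1 - (1 - w)))
       = (- 1) / (w * (1 + w ^ 3)) *
           (((1 + w ^ 2) ^ r - 1) / (1 - w ^ 2)
            + (w * ((1 - w) ^ r - 1)) / ((1 - w) ^ r * (1 + w)))"
proof -
  define w where "w = ratfun_var"
  note nz = ratfun_var_denominators_nonzero[OF w_def]
  \<comment> \<open>The factor \<open>q\<close> is nonzero because it divides
    \<open>1 + w ^ 3\<close>.\<close>
  have "1 + w ^ 3 = (1 + w) * (1 - w + w\<^sup>2)"
    by (simp add: algebra_simps power2_eq_square power3_eq_cube)
  then have q: "1 - w + w\<^sup>2 \<noteq> 0"
    using nz(5) by auto
  \<comment> \<open>For \<open>r = 0\<close> the exponent is -1, hence \<open>powi\<close>; the
    quotient form is \<open>b / (1 - w)\<close> and covers every \<open>r\<close> at once.\<close>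
  have "(1 - w) powi (int r - 1) = (1 - w) ^ r / (1 - w)"
    using nz(2) by (simp add: power_int_diff)
  then show ?thesis
    unfolding Let_def w_def[symmetric]
    using rational_identity[OF nz(1-3) q, of "(1 - w) ^ r" "(1 + w ^ 2) ^ r"] nz(2) by simp
qed

end
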